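(* Let $S\subseteq\mathbb{R}^m$ be closed and let $A,B:S\to\mathbb{S}^n_{\succeq0}$ be continuous. Then the function $x\mapsto\lambda_{\max}(A(x),B(x))$ from $S$ to $(-\infty,\infty]$ is nonnegative and lower semi-continuous on $S$. For each $\epsilon>0$ the approximation $x\mapsto\lambda_{\max}(A(x),B(x)+\epsilon I)$ from $S$ to $\mathbb{R}$ is continuous, and as $\epsilon\to0$ (with $\epsilon>0$) these functions epi-converge to $\lambda_{\max}(A(\cdot),B(\cdot))$ on $S$. Furthermore, if $S=\mathbb{R}^m_{\ge0}$ and $A,B:\mathbb{R}^m_{\ge0}\to\mathbb{S}^n_{\succeq0}$ are affine, then $\lambda_{\max}(A(\cdot),B(\cdot))$ is quasiconvex on $\mathbb{R}^m_{\ge0}$, and $\lambda_{\max}(A(\cdot),B(\cdot)+\epsilon I)$ is pseudoconvex on $\mathbb{R}^m_{\ge0}$ for each $\epsilon>0$.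
   Context: $\mathbb{R}^m_{\ge0}$ is the set of vectors with nonnegative components; $\mathbb{S}^n_{\succeq0}$ is the set of real symmetric positive semidefinite $n\times n$ matrices; $\mathrm{Ker}\,Y=\{v\in\mathbb{R}^n\mid Yv=0\}$. For $X,Y\in\mathbb{S}^n_{\succeq0}$, $$\lambda_{\max}(X,Y):=\begin{cases}\displaystyle\sup_{v\notin\mathrm{Ker}\,Y}\frac{v^\top Xv}{v^\top Yv} & (Y\neq0),\\ \infty & (X\neq0,\ Y=0),\\ 0 & (X=Y=0).\end{cases}$$ Quasiconvex: $f:D\to(-\infty,\infty]$ with $D\subset\mathbb{R}^m$ nonempty convex is quasiconvex if $\{x\in D\mid f(x)\le\alpha\}$ is convex for every $\alpha\in\mathbb{R}$. Pseudoconvex: a locally Lipschitz continuous $f:D\to\mathbb{R}$ with $D\subset\mathbb{R}^m$ nonempty convex is pseudoconvex if for all $x,y\in D$ and every Clarke subgradient $g\in\partial f(x)$, $f(x)>f(y)$ implies $\langle g,y-x\rangle<0$. For $f=\lambda_{\max}(A(\cdot),B(\cdot)+\epsilon I)$ with $A,B$ affine, the Clarke subdifferential at points of $D=\mathbb{R}^m_{\ge0}$ (including boundary points) is that of the natural extension $x\mapsto\sup_{v\ne0}\frac{v^\top A(x)v}{v^\top(B(x)+\epsilon I)v}$ to the open set $\{x\in\mathbb{R}^m\mid B(x)+\epsilon I\succ0\}\supseteq\mathbb{R}^m_{\ge0}$, where $A,B$ are extended affinely to $\mathbb{R}^m$. Epi-convergence: for $f:\mathbb{R}^m\to(-\infty,\infty]$,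 $\mathrm{epi} f=\{(x,\alpha)\in\mathbb{R}^m\times\mathbb{R}\mid f(x)\le\alpha\}$. A sequence $f^k$ epi-converges to $f$ if $\mathrm{epi} f^k$ converges to $\mathrm{epi} f$ in the Painlevé–Kuratowski sense, i.e. both the outer limit $\{z\mid\liminf_{k} d(z,\mathrm{epi} f^k)=0\}$ and the inner limit $\{z\mid\limsup_{k} d(z,\mathrm{epi} f^k)=0\}$ equal $\mathrm{epi} f$. A family indexed by $\epsilon>0$ epi-converges as $\epsilon\to0$ if it does so along every sequence $\epsilon_k\to0$ with $\epsilon_k>0$. Functions defined only on a subset of $\mathbb{R}^m$ are extended by $\infty$ outside it. *)

theory Defs
  imports "HOL-Analysis.Analysis"
begin

definition psd_matrices :: "(real^'n^'n) set" where
  "psd_matrices = {Y. transpose Y = Y \<and> (\<forall>v. 0 \<le> v \<bullet> (Y *v v))}"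

definition pd_matrices :: "(real^'n^'n) set" where
  "pd_matrices = {Y. transpose Y = Y \<and> (\<forall>v. v \<noteq> 0 \<longrightarrow> 0 < v \<bullet> (Y *v v))}"

definition mat_ker :: "real^'n^'n \<Rightarrow> (real^'n) set" where
  "mat_ker Y = {v. Y *v v = 0}"

definition nonneg_orthant :: "(real^'m) set" where
  "nonneg_orthant = {x. \<forall>i. 0 \<le> x $ i}"

definition lambda_max :: "real^'n^'n \<Rightarrow> real^'n^'n \<Rightarrow> ereal" where
  "lambda_max X Y =
     (if Y \<noteq> 0 then (SUP v \<in> - mat_ker Y. ereal ((v \<bullet> (X *v v)) / (v \<bullet> (Y *v v))))
      else if X \<noteq> 0 then \<infinity> else 0)"

text \<open>The supremum is real-valued, hence meaningful only when the quotients are bounded above,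
  which is the case whenever \<open>Y\<close> is positive definite.\<close>

definition rayleigh_sup :: "real^'n^'n \<Rightarrow> real^'n^'n \<Rightarrow> real" where
  "rayleigh_sup X Y = (SUP v \<in> - {0}. (v \<bullet> (X *v v)) / (v \<bullet> (Y *v v)))"

definition lsc_on :: "'a::topological_space set \<Rightarrow> ('a \<Rightarrow> ereal) \<Rightarrow> bool" where
  "lsc_on S f \<longleftrightarrow> (\<forall>x\<in>S. f x \<le> Liminf (at x within S) f)"

definition quasiconvex_on :: "'a::real_vector set \<Rightarrow> ('a \<Rightarrow> ereal) \<Rightarrow> bool" where
  "quasiconvex_on D f \<longleftrightarrow>
     D \<noteq> {} \<and> convex D \<and> (\<forall>x\<in>D. f x \<noteq> -\<infinity>) \<and> (\<forall>\<alpha>::real. convex {x \<in> D. f x \<le> ereal \<alpha>})"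

definition affine_map :: "('a::real_vector \<Rightarrow> 'b::real_vector) \<Rightarrow> bool" where
  "affine_map F \<longleftrightarrow> (\<exists>L c. linear L \<and> (\<forall>x. F x = L x + c))"

definition affine_on :: "'a::real_vector set \<Rightarrow> ('a \<Rightarrow> 'b::real_vector) \<Rightarrow> bool" where
  "affine_on D f \<longleftrightarrow> (\<exists>F. affine_map F \<and> (\<forall>x\<in>D. F x = f x))"

definition locally_lipschitz_on :: "'a::metric_space set \<Rightarrow> ('a \<Rightarrow> real) \<Rightarrow> bool" where
  "locally_lipschitz_on X f \<longleftrightarrow> (\<forall>x\<in>X. \<exists>u>0. \<exists>L. L-lipschitz_on (cball x u \<inter> X) f)"

text \<open>Clarke's generalized directional derivative
  \<open>limsup (F (y + t v) - F y) / t\<close> as \<open>y \<rightarrow> x\<close> and \<open>t \<rightarrow> 0+\<close>, and the subdifferential it supports.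
  Both depend only on \<open>F\<close> near \<open>x\<close>.\<close>

definition clarke_dderiv :: "('a::real_normed_vector \<Rightarrow> real) \<Rightarrow> 'a \<Rightarrow> 'a \<Rightarrow> ereal" where
  "clarke_dderiv F x v =
     Limsup (nhds x \<times>\<^sub>F at_right (0::real)) (\<lambda>(y, t). ereal ((F (y + t *\<^sub>R v) - F y) / t))"

definition clarke_subdiff :: "('a::real_inner \<Rightarrow> real) \<Rightarrow> 'a \<Rightarrow> 'a set" where
  "clarke_subdiff F x = {g. \<forall>v. ereal (g \<bullet> v) \<le> clarke_dderiv F x v}"

text \<open>\<open>f\<close> lives on \<open>D\<close>; its subgradients, also at boundary points of \<open>D\<close>, are by convention those
  of its extension \<open>F\<close> to the open set \<open>U\<close>.\<close>

definition pseudoconvex_on ::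
  "'a::real_inner set \<Rightarrow> ('a \<Rightarrow> real) \<Rightarrow> 'a set \<Rightarrow> ('a \<Rightarrow> real) \<Rightarrow> bool" where
  "pseudoconvex_on D f U F \<longleftrightarrow>
     D \<noteq> {} \<and> convex D \<and> locally_lipschitz_on D f \<and>
     open U \<and> D \<subseteq> U \<and> locally_lipschitz_on U F \<and> (\<forall>x\<in>D. F x = f x) \<and>
     (\<forall>x\<in>D. \<forall>y\<in>D. \<forall>g\<in>clarke_subdiff F x. f x > f y \<longrightarrow> g \<bullet> (y - x) < 0)"

definition extend_inf :: "'a set \<Rightarrow> ('a \<Rightarrow> ereal) \<Rightarrow> 'a \<Rightarrow> ereal" where
  "extend_inf S f x = (if x \<in> S then f x else \<infinity>)"

definition epi :: "('a \<Rightarrow> ereal) \<Rightarrow> ('a \<times> real) set" where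
  "epi f = {(x, \<alpha>). f x \<le> ereal \<alpha>}"

text \<open>Unlike \<^const>\<open>infdist\<close>, this gives distance \<open>\<infinity>\<close> to the empty set.\<close>

definition set_dist :: "'a::metric_space \<Rightarrow> 'a set \<Rightarrow> ereal" where
  "set_dist z C = (INF w\<in>C. ereal (dist z w))"

definition outer_limit :: "(nat \<Rightarrow> 'a::metric_space set) \<Rightarrow> 'a set" where
  "outer_limit C = {z. liminf (\<lambda>k. set_dist z (C k)) = 0}"

definition inner_limit :: "(nat \<Rightarrow> 'a::metric_space set) \<Rightarrow> 'a set" where
  "inner_limit C = {z. limsup (\<lambda>k. set_dist z (C k)) = 0}"

definition epi_converges :: "(nat \<Rightarrow> 'a::metric_space \<Rightarrow> ereal) \<Rightarrow> ('a \<Rightarrow> ereal) \<Rightarrow> bool" where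
  "epi_converges f g \<longleftrightarrow>
     outer_limit (\<lambda>k. epi (f k)) = epi g \<and> inner_limit (\<lambda>k. epi (f k)) = epi g"

definition epi_converges_at_right_0 ::
  "(real \<Rightarrow> 'a::metric_space \<Rightarrow> ereal) \<Rightarrow> ('a \<Rightarrow> ereal) \<Rightarrow> bool" where
  "epi_converges_at_right_0 f g \<longleftrightarrow>
     (\<forall>\<epsilon>. (\<forall>k. 0 < \<epsilon> k) \<longrightarrow> \<epsilon> \<longlonglongrightarrow> 0 \<longrightarrow> epi_converges (\<lambda>k. f (\<epsilon> k)) g)"

end

theory Submission
  imports Defs
begin

text \<open>For positive semidefinite \<open>X\<close> and \<open>Y\<close>, \<open>lambda_max X Y \<le> \<alpha>\<close> holds iff \<open>\<alpha> \<ge> 0\<close> and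
  \<open>\<alpha> *\<^sub>R Y - X\<close> is positive semidefinite. The positive semidefinite matrices form a closed convex
  cone, so sublevel sets are closed (semicontinuity) and convex in the affine case
  (quasiconvexity). The epigraph of \<open>lambda_max (A _) (B _)\<close> lies in those of the regularizations
  and contains every limit of their points (epi-convergence). For the regularized function,
  coercivity of the denominator makes the Rayleigh quotient locally Lipschitz in the matrices.
  Pseudoconvexity needs no formula for the Clarke subdifferential: if \<open>F y < F x\<close>, then \<open>F\<close> decreases
  at a uniform rate along \<open>y - x\<close> from every point near \<open>x\<close>, so the generalized directional
  derivative is negative.\<close>

section \<open>Quadratic forms\<close>

text \<open>The norm on \<open>real^'n^'n\<close> is the Frobenius norm; Cauchy-Schwarz on each row
  shows that it dominates the operator norm.\<close>

lemma abs_quadratic_form_le: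
  fixes X :: "real^'n^'n"
  shows "\<bar>v \<bullet> (X *v v)\<bar> \<le> norm X * (norm v)\<^sup>2"
proof -
  have "norm (X *v v) = L2_set (\<lambda>i. \<bar>X $ i \<bullet> v\<bar>) UNIV"
    by (simp add: norm_vec_def matrix_vector_mul_component)
  also have "\<dots> \<le> L2_set (\<lambda>i. norm (X $ i) * norm v) UNIV"
    by (intro L2_set_mono) (auto simp: Cauchy_Schwarz_ineq2)
  also have "\<dots> = norm X * norm v"
    by (simp add: norm_vec_def L2_set_left_distrib)
  finally have *: "norm (X *v v) \<le> norm X * norm v" .
  have "\<bar>v \<bullet> (X *v v)\<bar> \<le> norm v * norm (X *v v)"
    by (rule Cauchy_Schwarz_ineq2)
  also have "\<dots> \<le> norm v * (norm X * norm v)"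
    using * by (intro mult_left_mono) auto
  finally show ?thesis by (simp add: power2_eq_square mult_ac)
qed

lemma quadratic_form_simps:
  fixes X Y :: "real^'n^'n"
  shows "v \<bullet> ((X + Y) *v v) = v \<bullet> (X *v v) + v \<bullet> (Y *v v)"
    and "v \<bullet> ((X - Y) *v v) = v \<bullet> (X *v v) - v \<bullet> (Y *v v)"
    and "v \<bullet> ((c *\<^sub>R X) *v v) = c * (v \<bullet> (X *v v))"
    and "v \<bullet> (mat 1 *v v) = (norm v)\<^sup>2"
  by (simp_all add: matrix_vector_mult_add_rdistrib matrix_vector_mult_diff_rdistrib
      inner_add_right inner_diff_right scaleR_matrix_vector_assoc[symmetric] power2_norm_eq_inner)

lemma transpose_linear:
  "transpose (X + Y) = transpose X + transpose (Y :: real^'n^'m)"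
  "transpose (X - Y) = transpose X - transpose (Y :: real^'n^'m)"
  "transpose (c *\<^sub>R X) = c *\<^sub>R transpose (X :: real^'n^'m)"
  by (simp_all add: transpose_def vec_eq_iff)

text \<open>With \<open>w = Y *v v\<close>, moving from \<open>v\<close> to
  \<open>v - s *\<^sub>R w\<close> changes the form from 0 to \<open>s * (s * c - 2 * a)\<close>,
  which is negative for small \<open>s > 0\<close> unless \<open>w = 0\<close>. Hence the Rayleigh
  denominator is positive off the kernel.\<close>

lemma psd_mult_eq_0:
  fixes Y :: "real^'n^'n"
  assumes Y: "Y \<in> psd_matrices" and v: "v \<bullet> (Y *v v) = 0"
  shows "Y *v v = 0"
proof -
  define w where "w = Y *v v"
  define a where "a = w \<bullet> w"
  define c where "c = w \<bullet> (Y *v w)"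
  have c: "c \<ge> 0" using Y by (auto simp: psd_matrices_def c_def)
  have a: "a \<ge> 0" by (simp add: a_def)
  have sym: "transpose Y = Y" using Y by (auto simp: psd_matrices_def)
  have vw: "v \<bullet> (Y *v w) = a"
    by (metis a_def dot_lmul_matrix sym transpose_matrix_vector w_def)
  have wv: "w \<bullet> (Y *v v) = a" by (simp add: a_def w_def)
  \<comment> \<open>This choice gives \<open>s * c \<le> a\<close>, against the \<open>2 * a\<close>
    that nonnegativity would require; the \<open>+ 1\<close> covers \<open>c = 0\<close>.\<close>
  define s where "s = a / (c + 1)"
  have "0 \<le> (v - s *\<^sub>R w) \<bullet> (Y *v (v - s *\<^sub>R w))"
    using Y by (auto simp: psd_matrices_def)
  also have "\<dots> = s * (s * c - 2 * a)"
    by (simp add: v vw wv c_def[symmetric] algebra_simps)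
  finally have 1: "0 \<le> s * (s * c - 2 * a)" .
  have sc: "s * c \<le> a" using a c by (simp add: s_def field_simps)
  have "a = 0"
  proof (rule ccontr)
    assume "a \<noteq> 0"
    with a have "a > 0" by simp
    with c have "s > 0" by (simp add: s_def)
    with 1 have "s * c \<ge> 2 * a" by (simp add: zero_le_mult_iff)
    with sc \<open>a > 0\<close> show False by simp
  qed
  then show ?thesis by (simp add: a_def w_def)
qed

section \<open>Closedness and cone structure of the semidefinite matrices\<close>

lemma closed_psd_matrices: "closed (psd_matrices :: (real^'n^'n) set)"
proof -
  have eq: "psd_matrices = {Y :: real^'n^'n. transpose Y = Y} \<inter> (\<Inter>v. {Y. 0 \<le> v \<bullet> (Y *v v)})"
    by (auto simp: psd_matrices_def)
  have "closed {Y :: real^'n^'n. transpose Y = Y}"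
    unfolding transpose_def by (intro closed_Collect_eq continuous_intros)
  moreover have "closed {Y :: real^'n^'n. 0 \<le> v \<bullet> (Y *v v)}" for v
    unfolding matrix_vector_mult_def by (intro closed_Collect_le continuous_intros)
  ultimately show ?thesis unfolding eq by (intro closed_Int closed_INT ballI)
qed

lemma psd_matrices_add:
  "X \<in> psd_matrices \<Longrightarrow> Y \<in> psd_matrices \<Longrightarrow> X + Y \<in> psd_matrices"
  by (simp add: psd_matrices_def transpose_linear quadratic_form_simps)

lemma psd_matrices_scaleR:
  "X \<in> psd_matrices \<Longrightarrow> 0 \<le> c \<Longrightarrow> c *\<^sub>R X \<in> psd_matrices"
  by (simp add: psd_matrices_def transpose_linear quadratic_form_simps)

lemma mat_1_psd: "mat 1 \<in> psd_matrices"
  by (simp add: psd_matrices_def quadratic_form_simps)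

text \<open>The form attains its minimum on the compact unit sphere; homogeneity carries this
  positive value to all vectors.\<close>

lemma pd_matrices_coercive:
  fixes Y :: "real^'n^'n"
  assumes "Y \<in> pd_matrices"
  obtains c where "c > 0" "\<And>v. c * (norm v)\<^sup>2 \<le> v \<bullet> (Y *v v)"
proof -
  have "continuous_on (sphere 0 1) (\<lambda>v. v \<bullet> (Y *v v))"
    unfolding matrix_vector_mult_def by (intro continuous_intros)
  moreover have "sphere (0 :: real^'n) 1 \<noteq> {}" by simp
  ultimately obtain u where u: "u \<in> sphere 0 1"
    and min: "\<And>v. v \<in> sphere 0 1 \<Longrightarrow> u \<bullet> (Y *v u) \<le> v \<bullet> (Y *v v)"
    using continuous_attains_inf[OF compact_sphere, of 0 1 "\<lambda>v. v \<bullet> (Y *v v)"] by blast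
  show thesis
  proof
    have "u \<noteq> 0" using u by auto
    then show "0 < u \<bullet> (Y *v u)" using assms by (simp add: pd_matrices_def)
    fix v :: "real^'n"
    show "u \<bullet> (Y *v u) * (norm v)\<^sup>2 \<le> v \<bullet> (Y *v v)"
    proof (cases "v = 0")
      case False
      then have "u \<bullet> (Y *v u) \<le> sgn v \<bullet> (Y *v sgn v)"
        by (intro min) (simp add: norm_sgn)
      also have "\<dots> = (v \<bullet> (Y *v v)) / (norm v)\<^sup>2"
        by (simp add: sgn_div_norm matrix_vector_mult_scaleR power2_eq_square field_simps)
      finally show ?thesis using False by (simp add: field_simps)
    qed simp
  qed
qed

text \<open>A perturbation of Frobenius norm at most \<open>c / 2\<close> costs at most half of the
  coercivity bound, so one constant serves a whole neighbourhood.\<close>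

lemma coercive_near:
  fixes Y Y' :: "real^'n^'n"
  assumes "\<And>v. c * (norm v)\<^sup>2 \<le> v \<bullet> (Y *v v)" and "dist Y' Y \<le> c / 2"
  shows "c / 2 * (norm v)\<^sup>2 \<le> v \<bullet> (Y' *v v)"
proof -
  have "\<bar>v \<bullet> ((Y' - Y) *v v)\<bar> \<le> c / 2 * (norm v)\<^sup>2"
    using abs_quadratic_form_le[of v "Y' - Y"] assms(2)
    by (smt (verit) dist_norm mult_right_mono zero_le_power2)
  then have "- (c / 2 * (norm v)\<^sup>2) \<le> v \<bullet> (Y' *v v) - v \<bullet> (Y *v v)"
    unfolding quadratic_form_simps by linarith
  with assms(1)[of v] show ?thesis by simp
qed

section \<open>The generalized largest eigenvalue\<close>

text \<open>The supremum tests only vectors outside the kernel of \<open>Y\<close>, but kernel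
  vectors are limits of those. The conjunct \<open>0 \<le> \<alpha>\<close> encodes the value 0 at
  \<open>X = Y = 0\<close>.\<close>

lemma lambda_max_le_iff:
  fixes X Y :: "real^'n^'n"
  assumes X: "X \<in> psd_matrices" and Y: "Y \<in> psd_matrices"
  shows "lambda_max X Y \<le> ereal \<alpha> \<longleftrightarrow> 0 \<le> \<alpha> \<and> \<alpha> *\<^sub>R Y - X \<in> psd_matrices"
proof -
  have sym: "transpose (\<alpha> *\<^sub>R Y - X) = \<alpha> *\<^sub>R Y - X"
    using X Y by (simp add: psd_matrices_def transpose_linear)
  have X0: "0 \<le> v \<bullet> (X *v v)" and Y0: "0 \<le> v \<bullet> (Y *v v)" for v
    using X Y by (auto simp: psd_matrices_def)
  have psd: "\<alpha> *\<^sub>R Y - X \<in> psd_matrices \<longleftrightarrow> (\<forall>v. v \<bullet> (X *v v) \<le> \<alpha> * (v \<bullet> (Y *v v)))"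
    using sym by (simp add: psd_matrices_def quadratic_form_simps)
  show ?thesis
  proof (cases "Y = 0")
    case True
    \<comment> \<open>The form of \<open>X\<close> then vanishes identically, so every vector lies
      in the kernel of \<open>X\<close>.\<close>
    have "X = 0" if "\<forall>v. v \<bullet> (X *v v) \<le> 0"
      by (metis X X0 antisym matrix_eq matrix_vector_mult_0 psd_mult_eq_0 that)
    then show ?thesis
      unfolding psd using True by (auto simp: lambda_max_def)
  next
    case False
    obtain w where w: "Y *v w \<noteq> 0" using False by (metis matrix_eq matrix_vector_mult_0)
    have pos: "0 < v \<bullet> (Y *v v)" if "Y *v v \<noteq> 0" for v
      using psd_mult_eq_0[OF Y, of v] Y0[of v] that by linarith
    have le: "lambda_max X Y \<le> ereal \<alpha> \<longleftrightarrow>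
        (\<forall>v. Y *v v \<noteq> 0 \<longrightarrow> v \<bullet> (X *v v) \<le> \<alpha> * (v \<bullet> (Y *v v)))"
      using False pos by (auto simp: lambda_max_def SUP_le_iff mat_ker_def divide_le_eq)
    show ?thesis
      unfolding le psd
    proof (intro iffI conjI allI)
      assume *: "\<forall>v. Y *v v \<noteq> 0 \<longrightarrow> v \<bullet> (X *v v) \<le> \<alpha> * (v \<bullet> (Y *v v))"
      then have "0 \<le> \<alpha> * (w \<bullet> (Y *v w))" using w X0[of w] by (meson order_trans)
      with pos[OF w] show "0 \<le> \<alpha>" by (simp add: zero_le_mult_iff)
      fix v
      show "v \<bullet> (X *v v) \<le> \<alpha> * (v \<bullet> (Y *v v))"
      proof (cases "Y *v v = 0")
        case True
        \<comment> \<open>The kernel vector is approached along \<open>w\<close>: since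
          \<open>Y *v v = 0\<close>, each \<open>Y *v u n\<close> is a nonzero multiple of
          \<open>Y *v w\<close>.\<close>
        define u where "u = (\<lambda>n. v + inverse (real (Suc n)) *\<^sub>R w)"
        have "(\<lambda>n. v + inverse (real (Suc n)) *\<^sub>R w) \<longlonglongrightarrow> v + 0 *\<^sub>R w"
          by (intro tendsto_intros LIMSEQ_inverse_real_of_nat)
        then have u: "u \<longlonglongrightarrow> v" by (simp add: u_def)
        have Yu: "u n \<bullet> (X *v u n) \<le> \<alpha> * (u n \<bullet> (Y *v u n))" for n
        proof -
          have "Y *v u n = inverse (real (Suc n)) *\<^sub>R (Y *v w)"
            using True by (simp add: u_def matrix_vector_right_distrib matrix_vector_mult_scaleR)
          with w have "Y *v u n \<noteq> 0" by simp
          with * show ?thesis by blast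
        qed
        have lim: "(\<lambda>n. u n \<bullet> (M *v u n)) \<longlonglongrightarrow> v \<bullet> (M *v v)" for M :: "real^'n^'n"
          unfolding matrix_vector_mult_def by (intro tendsto_intros u)
        show ?thesis
          by (rule LIMSEQ_le[OF lim tendsto_mult_left[OF lim]]) (use Yu in auto)
      qed (use * in blast)
    qed auto
  qed
qed

text \<open>A negative real above the value would violate the sign condition in
  \<open>lambda_max_le_iff\<close>.\<close>

lemma lambda_max_nonneg:
  assumes "X \<in> psd_matrices" "Y \<in> psd_matrices"
  shows "0 \<le> lambda_max X Y"
proof (rule ccontr)
  assume "\<not> 0 \<le> lambda_max X Y"
  then obtain r where "lambda_max X Y < ereal r" "ereal r < 0"
    by (metis ereal_dense2 not_le)
  with lambda_max_le_iff[OF assms, of r] show False by auto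
qed

text \<open>Coercivity bounds every quotient by \<open>norm X / c\<close>, so the real supremum is
  meaningful. \<open>X\<close> is arbitrary because an affine extension may fail to be semidefinite
  outside the orthant.\<close>

lemma rayleigh_sup_coercive:
  fixes X Y :: "real^'n^'n"
  assumes c: "c > 0" and Y: "\<And>v. c * (norm v)\<^sup>2 \<le> v \<bullet> (Y *v v)"
  shows "rayleigh_sup X Y \<le> \<beta> \<longleftrightarrow> (\<forall>v. v \<bullet> (X *v v) \<le> \<beta> * (v \<bullet> (Y *v v)))"
    and "\<bar>rayleigh_sup X Y\<bar> \<le> norm X / c"
    and "lambda_max X Y = ereal (rayleigh_sup X Y)"
proof -
  have pos: "0 < v \<bullet> (Y *v v)" if "v \<noteq> 0" for v
    using Y[of v] c that by (smt (verit) mult_pos_pos zero_less_norm_iff zero_less_power)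
  have bd: "\<bar>(v \<bullet> (X *v v)) / (v \<bullet> (Y *v v))\<bar> \<le> norm X / c" if "v \<noteq> 0" for v
  proof -
    have "\<bar>v \<bullet> (X *v v)\<bar> * c \<le> norm X * (c * (norm v)\<^sup>2)"
      using mult_right_mono[OF abs_quadratic_form_le[of v X], of c] c by (simp add: mult_ac)
    also have "\<dots> \<le> norm X * (v \<bullet> (Y *v v))" using Y by (intro mult_left_mono) auto
    finally show ?thesis using pos[OF that] c by (simp add: field_simps)
  qed
  have bdd: "bdd_above ((\<lambda>v. (v \<bullet> (X *v v)) / (v \<bullet> (Y *v v))) ` (- {0}))"
    using bd unfolding abs_le_iff by (intro bdd_aboveI[of _ "norm X / c"]) blast
  \<comment> \<open>Index types are nonempty, so a nonzero vector exists and the supremum runs over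
    a nonempty set.\<close>
  have "axis undefined 1 \<noteq> (0 :: real^'n)" by simp
  then obtain e :: "real^'n" where e: "e \<noteq> 0" by blast
  then have ne: "- {0 :: real^'n} \<noteq> {}" by blast
  show iff: "rayleigh_sup X Y \<le> \<beta> \<longleftrightarrow> (\<forall>v. v \<bullet> (X *v v) \<le> \<beta> * (v \<bullet> (Y *v v)))" for \<beta>
  proof -
    have "rayleigh_sup X Y \<le> \<beta> \<longleftrightarrow>
        (\<forall>v\<in>- {0}. (v \<bullet> (X *v v)) / (v \<bullet> (Y *v v)) \<le> \<beta>)"
      unfolding rayleigh_sup_def by (rule cSUP_le_iff[OF ne bdd])
    also have "\<dots> \<longleftrightarrow> (\<forall>v. v \<noteq> 0 \<longrightarrow> v \<bullet> (X *v v) \<le> \<beta> * (v \<bullet> (Y *v v)))"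
      using pos by (auto simp: divide_le_eq)
    also have "\<dots> \<longleftrightarrow> (\<forall>v. v \<bullet> (X *v v) \<le> \<beta> * (v \<bullet> (Y *v v)))"
      by (metis inner_zero_left mult_zero_right order_refl)
    finally show ?thesis .
  qed
  have "rayleigh_sup X Y \<le> norm X / c"
    using bd unfolding rayleigh_sup_def abs_le_iff by (intro cSUP_least[OF ne]) blast
  moreover have "(e \<bullet> (X *v e)) / (e \<bullet> (Y *v e)) \<le> rayleigh_sup X Y"
    unfolding rayleigh_sup_def using e by (intro cSUP_upper bdd) auto
  ultimately show "\<bar>rayleigh_sup X Y\<bar> \<le> norm X / c" using bd[OF e] by linarith
  have ker: "- mat_ker Y = - {0}"
    using pos by (auto simp: mat_ker_def) (metis inner_zero_right less_irrefl)
  have Y0: "Y \<noteq> 0" using pos[OF e] by auto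
  have "lambda_max X Y \<le> ereal r \<longleftrightarrow> rayleigh_sup X Y \<le> r" for r
    using Y0 pos unfolding iff
    by (auto simp: lambda_max_def ker SUP_le_iff divide_le_eq)
  \<comment> \<open>One finite quotient bounds the supremum below, excluding
    \<open>-\<infinity>\<close>; equal real upper bounds then force equal values.\<close>
  moreover have "ereal ((e \<bullet> (X *v e)) / (e \<bullet> (Y *v e))) \<le> lambda_max X Y"
    unfolding lambda_max_def ker if_P[OF Y0] using e by (intro SUP_upper) simp
  ultimately show "lambda_max X Y = ereal (rayleigh_sup X Y)"
    by (cases "lambda_max X Y") (auto intro: antisym)
qed

text \<open>Changing both matrices costs at most \<open>K * (norm v)\<^sup>2\<close>, which
  coercivity of \<open>Y'\<close> turns into \<open>K / c\<close> times the new denominator.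
  Exchanging the two pairs makes the estimate two-sided.\<close>

lemma rayleigh_sup_perturb:
  fixes X Y X' Y' :: "real^'n^'n"
  assumes c: "c > 0" and Y: "\<And>v. c * (norm v)\<^sup>2 \<le> v \<bullet> (Y *v v)"
    and Y': "\<And>v. c * (norm v)\<^sup>2 \<le> v \<bullet> (Y' *v v)"
  shows "rayleigh_sup X' Y' \<le> rayleigh_sup X Y + (dist X' X + norm X / c * dist Y' Y) / c"
proof -
  define \<rho> where "\<rho> = rayleigh_sup X Y"
  \<comment> \<open>The denominator error is weighted by the bound \<open>norm X / c\<close> on
    \<open>\<bar>\<rho>\<bar>\<close>.\<close>
  define K where "K = dist X' X + norm X / c * dist Y' Y"
  have K: "K \<ge> 0" using c by (simp add: K_def)
  have \<rho>: "\<bar>\<rho>\<bar> \<le> norm X / c"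
    unfolding \<rho>_def by (rule rayleigh_sup_coercive(2)[OF c Y])
  have "rayleigh_sup X' Y' \<le> \<rho> + K / c"
    unfolding rayleigh_sup_coercive(1)[OF c Y']
  proof
    fix v
    have 1: "\<bar>v \<bullet> (X' *v v) - v \<bullet> (X *v v)\<bar> \<le> dist X' X * (norm v)\<^sup>2"
      using abs_quadratic_form_le[of v "X' - X"] by (simp add: quadratic_form_simps dist_norm)
    have "\<bar>v \<bullet> (Y' *v v) - v \<bullet> (Y *v v)\<bar> \<le> dist Y' Y * (norm v)\<^sup>2"
      using abs_quadratic_form_le[of v "Y' - Y"] by (simp add: quadratic_form_simps dist_norm)
    then have 2: "\<bar>\<rho> * (v \<bullet> (Y' *v v) - v \<bullet> (Y *v v))\<bar> \<le> norm X / c * (dist Y' Y * (norm v)\<^sup>2)"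
      unfolding abs_mult by (intro mult_mono \<rho>) (use c in auto)
    have 3: "v \<bullet> (X *v v) \<le> \<rho> * (v \<bullet> (Y *v v))"
      using rayleigh_sup_coercive(1)[OF c Y, of X \<rho>] by (simp add: \<rho>_def)
    have 4: "K * (norm v)\<^sup>2 \<le> K / c * (v \<bullet> (Y' *v v))"
      using mult_left_mono[OF Y'[of v], of "K / c"] K c by simp
    have "K * (norm v)\<^sup>2 = dist X' X * (norm v)\<^sup>2 + norm X / c * (dist Y' Y * (norm v)\<^sup>2)"
      by (simp add: K_def algebra_simps)
    with 1 2 3 4 show "v \<bullet> (X' *v v) \<le> (\<rho> + K / c) * (v \<bullet> (Y' *v v))"
      unfolding right_diff_distrib distrib_right by linarith
  qed
  then show ?thesis by (simp add: \<rho>_def K_def)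
qed


section \<open>Affine matrix pencils\<close>

lemma affine_map_lipschitz:
  fixes F :: "'a::euclidean_space \<Rightarrow> 'b::real_normed_vector"
  assumes "affine_map F"
  obtains K where "K > 0" "\<And>x y. dist (F x) (F y) \<le> K * dist x y"
proof -
  obtain L c where L: "linear L" and F: "\<And>x. F x = L x + c"
    using assms by (auto simp: affine_map_def)
  obtain K where K: "K > 0" "\<And>x. norm (L x) \<le> K * norm x"
    using linear_bounded_pos[OF L] by blast
  have "dist (F x) (F y) \<le> K * dist x y" for x y
    using K(2)[of "x - y"] by (simp add: F dist_norm linear_diff[OF L])
  with K(1) show thesis by (rule that)
qed

lemma affine_map_convex_comb:
  assumes "affine_map F"
  shows "F ((1 - t) *\<^sub>R x + t *\<^sub>R y) = (1 - t) *\<^sub>R F x + t *\<^sub>R F y"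
proof -
  obtain L c where L: "linear L" and F: "\<And>x. F x = L x + c"
    using assms by (auto simp: affine_map_def)
  show ?thesis
    by (simp add: F linear_add[OF L] linear_diff[OF L] linear_scale[OF L] scaleR_add_right scaleR_left_diff_distrib)
qed

lemma affine_map_add_const: "affine_map F \<Longrightarrow> affine_map (\<lambda>x. F x + d)"
  unfolding affine_map_def by (metis add.assoc)

text \<open>Splitting \<open>x\<close> into positive and negative parts gives
  \<open>F x = F p - F q + F 0\<close> with all three arguments in the orthant. Symmetry off the
  orthant matters because \<open>pd_matrices\<close> includes it.\<close>

lemma affine_map_symmetric:
  fixes F :: "real^'m \<Rightarrow> real^'n^'n"
  assumes "affine_map F" and sym: "\<And>x. x \<in> nonneg_orthant \<Longrightarrow> transpose (F x) = F x"
  shows "transpose (F x) = F x"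
proof -
  obtain L c where L: "linear L" and F: "\<And>x. F x = L x + c"
    using assms by (auto simp: affine_map_def)
  define p where "p = (\<chi> i. max 0 (x $ i))"
  define q where "q = (\<chi> i. max 0 (- x $ i))"
  have pq: "p \<in> nonneg_orthant" "q \<in> nonneg_orthant" "0 \<in> nonneg_orthant"
    by (auto simp: p_def q_def nonneg_orthant_def)
  have x: "x = p - q" by (auto simp: p_def q_def vec_eq_iff max_def)
  have "F x = F p - F q + F 0"
    by (simp add: F x linear_diff[OF L] linear_0[OF L])
  then show ?thesis using sym pq by (simp add: transpose_linear)
qed

text \<open>This supplies the open domain of the extension. Half of the coercivity constant survives
  near each point because \<open>Y\<close> is Lipschitz.\<close>

lemma open_pd_preimage:
  fixes Y :: "'a::euclidean_space \<Rightarrow> real^'n^'n"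
  assumes "affine_map Y" and sym: "\<And>x. transpose (Y x) = Y x"
  shows "open {x. Y x \<in> pd_matrices}"
  unfolding open_contains_cball
proof
  fix x assume "x \<in> {x. Y x \<in> pd_matrices}"
  then obtain c where c: "c > 0" "\<And>v. c * (norm v)\<^sup>2 \<le> v \<bullet> (Y x *v v)"
    using pd_matrices_coercive by blast
  obtain K where K: "K > 0" "\<And>x y. dist (Y x) (Y y) \<le> K * dist x y"
    using affine_map_lipschitz[OF assms(1)] by blast
  \<comment> \<open>Within this radius \<open>Y\<close> moves by at most \<open>c / 2\<close>, as
    \<open>coercive_near\<close> requires.\<close>
  have "Y y \<in> pd_matrices" if "y \<in> cball x (c / 2 / K)" for y
  proof -
    have "K * dist y x \<le> c / 2"
      using that K(1) by (simp add: dist_commute field_simps)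
    then have "dist (Y y) (Y x) \<le> c / 2" using K(2)[of y x] by linarith
    then have *: "c / 2 * (norm v)\<^sup>2 \<le> v \<bullet> (Y y *v v)" for v
      by (rule coercive_near[OF c(2)])
    have "0 < c / 2 * (norm v)\<^sup>2" if "v \<noteq> 0" for v :: "real^'n"
      using that c(1) by simp
    with * show ?thesis using sym unfolding pd_matrices_def
      by (blast intro: less_le_trans)
  qed
  then show "\<exists>e>0. cball x e \<subseteq> {x. Y x \<in> pd_matrices}"
    using c(1) K(1) by (intro exI[of _ "c / 2 / K"]) auto
qed

text \<open>On a small ball the denominators share a coercivity constant and
  \<open>norm (X y)\<close> is bounded, so \<open>rayleigh_sup_perturb\<close> applies in both
  orders with one constant.\<close>

lemma locally_lipschitz_rayleigh_sup:
  fixes X Y :: "'a::euclidean_space \<Rightarrow> real^'n^'n"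
  assumes "affine_map X" "affine_map Y"
  shows "locally_lipschitz_on {x. Y x \<in> pd_matrices} (\<lambda>x. rayleigh_sup (X x) (Y x))"
  unfolding locally_lipschitz_on_def
proof
  fix x assume "x \<in> {x. Y x \<in> pd_matrices}"
  then obtain c where c: "c > 0" "\<And>v. c * (norm v)\<^sup>2 \<le> v \<bullet> (Y x *v v)"
    using pd_matrices_coercive by blast
  obtain K where K: "K > 0" "\<And>x y. dist (Y x) (Y y) \<le> K * dist x y"
    using affine_map_lipschitz[OF assms(2)] by blast
  obtain J where J: "J > 0" "\<And>x y. dist (X x) (X y) \<le> J * dist x y"
    using affine_map_lipschitz[OF assms(1)] by blast
  define u where "u = c / 2 / K"
  have u: "u > 0" using c K by (simp add: u_def)
  define M where "M = norm (X x) + J * u"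
  have M: "norm (X y) \<le> M" if "y \<in> cball x u" for y
  proof -
    have "norm (X y) \<le> norm (X x) + dist (X y) (X x)"
      by (metis dist_norm norm_triangle_sub)
    also have "dist (X y) (X x) \<le> J * dist y x" by (rule J)
    also have "J * dist y x \<le> J * u"
      using that J(1) by (intro mult_left_mono) (auto simp: dist_commute)
    finally show ?thesis by (simp add: M_def)
  qed
  have cY: "c / 2 * (norm v)\<^sup>2 \<le> v \<bullet> (Y y *v v)" if "y \<in> cball x u" for y v
  proof (rule coercive_near[OF c(2)])
    have "K * dist y x \<le> c / 2"
      using that K(1) by (simp add: u_def dist_commute field_simps)
    then show "dist (Y y) (Y x) \<le> c / 2" using K(2)[of y x] by linarith
  qed
  \<comment> \<open>The perturbation bound with coercivity \<open>c / 2\<close>, numerator bound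
    \<open>M\<close> and Lipschitz constants \<open>J\<close> of \<open>X\<close> and
    \<open>K\<close> of \<open>Y\<close>.\<close>
  define L where "L = (J + M / (c / 2) * K) / (c / 2)"
  have M0: "M \<ge> 0" using J(1) u by (simp add: M_def)
  have step: "rayleigh_sup (X y) (Y y) \<le> rayleigh_sup (X z) (Y z) + L * dist y z"
    if y: "y \<in> cball x u" and z: "z \<in> cball x u" for y z
  proof -
    have "rayleigh_sup (X y) (Y y) \<le> rayleigh_sup (X z) (Y z)
        + (dist (X y) (X z) + norm (X z) / (c / 2) * dist (Y y) (Y z)) / (c / 2)"
      using c(1) cY[OF y] cY[OF z] by (intro rayleigh_sup_perturb) auto
    also have "\<dots> \<le> rayleigh_sup (X z) (Y z)
        + (J * dist y z + M / (c / 2) * (K * dist y z)) / (c / 2)"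
      using c(1) M0 by (intro add_mono divide_right_mono mult_mono J K M[OF z] order_refl) auto
    finally show ?thesis by (simp add: L_def algebra_simps add_divide_distrib)
  qed
  have "L-lipschitz_on (cball x u) (\<lambda>x. rayleigh_sup (X x) (Y x))"
  proof (rule lipschitz_onI)
    show "0 \<le> L" using M0 c(1) J(1) K(1) by (simp add: L_def)
    fix y z assume "y \<in> cball x u" "z \<in> cball x u"
    then show "dist (rayleigh_sup (X y) (Y y)) (rayleigh_sup (X z) (Y z)) \<le> L * dist y z"
      using step[of y z] step[of z y] unfolding dist_real_def by (simp add: dist_commute)
  qed
  then have "L-lipschitz_on (cball x u \<inter> {x. Y x \<in> pd_matrices}) (\<lambda>x. rayleigh_sup (X x) (Y x))"
    by (rule lipschitz_on_subset) auto
  with u show "\<exists>u>0. \<exists>L. L-lipschitz_on (cball x u \<inter> {x. Y x \<in> pd_matrices})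
      (\<lambda>x. rayleigh_sup (X x) (Y x))"
    by blast
qed

section \<open>Locally Lipschitz functions and Clarke subgradients\<close>

lemma locally_lipschitz_on_subset:
  assumes "locally_lipschitz_on U F" "D \<subseteq> U"
  shows "locally_lipschitz_on D F"
  unfolding locally_lipschitz_on_def
proof
  fix x assume "x \<in> D"
  then obtain u L where "u > 0" "L-lipschitz_on (cball x u \<inter> U) F"
    using assms unfolding locally_lipschitz_on_def by blast
  moreover have "cball x u \<inter> D \<subseteq> cball x u \<inter> U" using assms(2) by blast
  ultimately show "\<exists>u>0. \<exists>L. L-lipschitz_on (cball x u \<inter> D) F"
    using lipschitz_on_subset by blast
qed

lemma locally_lipschitz_on_isCont:
  assumes "locally_lipschitz_on U F" "open U" "x \<in> U"
  shows "isCont F x"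
proof -
  obtain u L where u: "u > 0" "L-lipschitz_on (cball x u \<inter> U) F"
    using assms unfolding locally_lipschitz_on_def by blast
  then have "continuous_on (ball x u \<inter> U) F"
    by (meson Int_mono ball_subset_cball continuous_on_subset lipschitz_on_continuous_on order_refl)
  moreover have "open (ball x u \<inter> U)" "x \<in> ball x u \<inter> U" using assms u by auto
  ultimately show ?thesis by (simp add: continuous_on_eq_continuous_at)
qed

text \<open>All difference quotients with base point near \<open>x\<close> and small step are at
  most \<open>-\<delta>\<close>, hence so is their limsup, which bounds
  \<open>g \<bullet> v\<close>.\<close>

lemma clarke_subdiff_descent:
  assumes "g \<in> clarke_subdiff F x" and "\<delta> > 0"
    and "eventually (\<lambda>z. \<forall>t. 0 < t \<and> t < 1 \<longrightarrow> F (z + t *\<^sub>R v) \<le> F z - t * \<delta>) (nhds x)"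
  shows "g \<bullet> v < 0"
proof -
  have t: "eventually (\<lambda>t. 0 < t \<and> t < (1::real)) (at_right 0)"
    by (simp add: eventually_at_right_field) (metis zero_less_one)
  have "eventually (\<lambda>(z, t). ereal ((F (z + t *\<^sub>R v) - F z) / t) \<le> ereal (- \<delta>))
      (nhds x \<times>\<^sub>F at_right 0)"
    by (rule eventually_mono[OF eventually_prodI[OF assms(3) t]]) (auto simp: field_simps)
  then have "clarke_dderiv F x v \<le> ereal (- \<delta>)"
    unfolding clarke_dderiv_def by (intro Limsup_bounded) (simp add: case_prod_unfold)
  moreover have "ereal (g \<bullet> v) \<le> clarke_dderiv F x v"
    using assms(1) by (simp add: clarke_subdiff_def)
  ultimately have "ereal (g \<bullet> v) \<le> ereal (- \<delta>)" by (rule order_trans[rotated])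
  with assms(2) show ?thesis by simp
qed

text \<open>With \<open>N x = v \<bullet> (X x *v v)\<close> and \<open>D x = v \<bullet> (Y x *v v)\<close>, affinity gives
  \<open>N (z + t d) - F z * D (z + t d) \<le> - t (F z - F (z + d)) D (z + d)\<close>, so the quotient decreases
  along \<open>d = y - x\<close> at a rate that is uniform for \<open>z\<close> near \<open>x\<close>.\<close>

lemma rayleigh_sup_clarke_descent:
  fixes X Y :: "'a::euclidean_space \<Rightarrow> real^'n^'n"
  defines "F \<equiv> \<lambda>x. rayleigh_sup (X x) (Y x)"
  assumes X: "affine_map X" and Y: "affine_map Y" and sym: "\<And>x. transpose (Y x) = Y x"
    and x: "Y x \<in> pd_matrices" and y: "Y y \<in> pd_matrices"
    and less: "F y < F x" and g: "g \<in> clarke_subdiff F x"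
  shows "g \<bullet> (y - x) < 0"
proof -
  define d where "d = y - x"
  have cont: "isCont F z" if "Y z \<in> pd_matrices" for z
    using locally_lipschitz_on_isCont[OF locally_lipschitz_rayleigh_sup[OF X Y]
        open_pd_preimage[OF Y sym]] that by (simp add: F_def)
  obtain K where K: "K > 0" "\<And>x y. dist (Y x) (Y y) \<le> K * dist x y"
    using affine_map_lipschitz[OF Y] by blast
  have contY: "isCont Y z" for z
  proof -
    have "K-lipschitz_on UNIV Y" using K by (intro lipschitz_onI) auto
    then show ?thesis
      using lipschitz_on_continuous_on continuous_on_eq_continuous_at open_UNIV by blast
  qed
  obtain a where a: "a > 0" "\<And>v. a * (norm v)\<^sup>2 \<le> v \<bullet> (Y x *v v)"
    using pd_matrices_coercive[OF x] by blast
  obtain b where b: "b > 0" "\<And>v. b * (norm v)\<^sup>2 \<le> v \<bullet> (Y y *v v)"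
    using pd_matrices_coercive[OF y] by blast
  \<comment> \<open>A common coercivity constant near both endpoints; convexity passes it on to the
    points between.\<close>
  define c where "c = min a b / 2"
  have c: "c > 0" using a b by (simp add: c_def)
  \<comment> \<open>Bounds \<open>norm (Y z)\<close> near both endpoints, where \<open>Y\<close>
    deviates by less than 1.\<close>
  define M where "M = norm (Y x) + norm (Y y) + 2"
  have M: "M > 0" by (simp add: M_def add_nonneg_pos)
  \<comment> \<open>Splitting the gap into thirds keeps \<open>F (z + d) < p < q < F z\<close> for
    all \<open>z\<close> near \<open>x\<close>, by continuity at both endpoints.\<close>
  define p q where "p = (F x + 2 * F y) / 3" and "q = (2 * F x + F y) / 3"
  have pq: "F y < p" "p < q" "q < F x" using less by (auto simp: p_def q_def)
  \<comment> \<open>The factor \<open>c / M\<close> compares the denominator at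
    \<open>z + d\<close>, at least \<open>c * (norm v)\<^sup>2\<close>, with that at
    \<open>w\<close>, at most \<open>M * (norm v)\<^sup>2\<close>.\<close>
  define \<delta> where "\<delta> = (q - p) * (c / M)"
  have \<delta>: "\<delta> > 0" using pq c M by (simp add: \<delta>_def)
  have "((\<lambda>z. z + d) \<longlongrightarrow> x + d) (nhds x)"
    by (intro tendsto_intros filterlim_ident)
  then have lim: "filterlim (\<lambda>z. z + d) (nhds y) (nhds x)" by (simp add: d_def)
  have tend: "(f \<longlongrightarrow> f z) (nhds z)" if "isCont f z" for z and f :: "'a \<Rightarrow> 'b::topological_space"
    using that by (simp add: isCont_def tendsto_at_iff_tendsto_nhds)
  have Yx: "eventually (\<lambda>z. dist (Y z) (Y x) < min (a / 2) 1) (nhds x)"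
    using a by (intro tendstoD[OF tend[OF contY]]) simp
  have "eventually (\<lambda>z. dist (Y z) (Y y) < min (b / 2) 1) (nhds y)"
    using b by (intro tendstoD[OF tend[OF contY]]) simp
  then have Yy: "eventually (\<lambda>z. dist (Y (z + d)) (Y y) < min (b / 2) 1) (nhds x)"
    by (rule eventually_compose_filterlim[OF _ lim])
  have Fx: "eventually (\<lambda>z. q < F z) (nhds x)"
    by (rule order_tendstoD(1)[OF tend[OF cont[OF x]] pq(3)])
  have Fy: "eventually (\<lambda>z. F (z + d) < p) (nhds x)"
    by (rule eventually_compose_filterlim[OF order_tendstoD(2)[OF tend[OF cont[OF y]] pq(1)] lim])
  have "eventually (\<lambda>z. \<forall>t. 0 < t \<and> t < 1 \<longrightarrow> F (z + t *\<^sub>R d) \<le> F z - t * \<delta>) (nhds x)"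
    using Yx Yy Fx Fy
  proof (eventually_elim, intro allI impI)
    fix z t
    assume Yx: "dist (Y z) (Y x) < min (a / 2) 1" and Yy: "dist (Y (z + d)) (Y y) < min (b / 2) 1"
      and Fx: "q < F z" and Fy: "F (z + d) < p" and "0 < t \<and> t < (1::real)"
    then have t: "0 < t" "t < 1" by auto
    define w where "w = z + t *\<^sub>R d"
    have w: "w = (1 - t) *\<^sub>R z + t *\<^sub>R (z + d)" by (simp add: w_def algebra_simps)
    have Xw: "v \<bullet> (X w *v v) = (1 - t) * (v \<bullet> (X z *v v)) + t * (v \<bullet> (X (z + d) *v v))" for v
      unfolding w affine_map_convex_comb[OF X] by (simp add: quadratic_form_simps)
    have Yw: "v \<bullet> (Y w *v v) = (1 - t) * (v \<bullet> (Y z *v v)) + t * (v \<bullet> (Y (z + d) *v v))" for v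
      unfolding w affine_map_convex_comb[OF Y] by (simp add: quadratic_form_simps)
    have cz: "c * (norm v)\<^sup>2 \<le> v \<bullet> (Y z *v v)" for v
    proof -
      have "c * (norm v)\<^sup>2 \<le> a / 2 * (norm v)\<^sup>2" by (intro mult_right_mono) (auto simp: c_def)
      also have "\<dots> \<le> v \<bullet> (Y z *v v)" using Yx by (intro coercive_near[OF a(2)]) simp
      finally show ?thesis .
    qed
    have cd: "c * (norm v)\<^sup>2 \<le> v \<bullet> (Y (z + d) *v v)" for v
    proof -
      have "c * (norm v)\<^sup>2 \<le> b / 2 * (norm v)\<^sup>2" by (intro mult_right_mono) (auto simp: c_def)
      also have "\<dots> \<le> v \<bullet> (Y (z + d) *v v)" using Yy by (intro coercive_near[OF b(2)]) simp
      finally show ?thesis .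
    qed
    \<comment> \<open>\<open>convex_bound_le\<close> bounds convex combinations from above, hence
      the negated terms.\<close>
    have cw: "c * (norm v)\<^sup>2 \<le> v \<bullet> (Y w *v v)" for v
      unfolding Yw using convex_bound_le[of "- (v \<bullet> (Y z *v v))" "- (c * (norm v)\<^sup>2)"
          "- (v \<bullet> (Y (z + d) *v v))" "1 - t" t] cz[of v] cd[of v] t by simp
    have "norm (Y z) \<le> M" "norm (Y (z + d)) \<le> M"
      using Yx Yy norm_triangle_sub[of "Y z" "Y x"] norm_triangle_sub[of "Y (z + d)" "Y y"]
        norm_ge_zero[of "Y x"] norm_ge_zero[of "Y y"] unfolding M_def dist_norm min_less_iff_conj
      by linarith+
    then have Mz: "v \<bullet> (Y z *v v) \<le> M * (norm v)\<^sup>2" "v \<bullet> (Y (z + d) *v v) \<le> M * (norm v)\<^sup>2" for v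
      using abs_quadratic_form_le[of v "Y z"] abs_quadratic_form_le[of v "Y (z + d)"]
      by (smt (verit) mult_right_mono zero_le_power2)+
    have Mw: "v \<bullet> (Y w *v v) \<le> M * (norm v)\<^sup>2" for v
      unfolding Yw using convex_bound_le[OF Mz] t by simp
    have "rayleigh_sup (X w) (Y w) \<le> F z - t * \<delta>"
      unfolding rayleigh_sup_coercive(1)[OF c cw]
    proof
      fix v
      have Nz: "v \<bullet> (X z *v v) \<le> F z * (v \<bullet> (Y z *v v))"
        using rayleigh_sup_coercive(1)[OF c cz, of "X z" "F z"] by (simp add: F_def)
      have Nd: "v \<bullet> (X (z + d) *v v) \<le> p * (v \<bullet> (Y (z + d) *v v))"
        using rayleigh_sup_coercive(1)[OF c cd, of "X (z + d)" p] Fy by (simp add: F_def)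
      have "\<delta> * (v \<bullet> (Y w *v v)) \<le> \<delta> * (M * (norm v)\<^sup>2)"
        using \<delta> Mw by (intro mult_left_mono) auto
      also have "\<dots> = (q - p) * (c * (norm v)\<^sup>2)" using M by (simp add: \<delta>_def)
      also have "\<dots> \<le> (F z - p) * (v \<bullet> (Y (z + d) *v v))"
        using pq Fx c cd by (intro mult_mono) auto
      finally have "t * (\<delta> * (v \<bullet> (Y w *v v))) \<le> t * ((F z - p) * (v \<bullet> (Y (z + d) *v v)))"
        using t by (intro mult_left_mono) auto
      moreover have "(1 - t) * (v \<bullet> (X z *v v)) \<le> (1 - t) * (F z * (v \<bullet> (Y z *v v)))"
        using t Nz by (intro mult_left_mono) auto
      moreover have "t * (v \<bullet> (X (z + d) *v v)) \<le> t * (p * (v \<bullet> (Y (z + d) *v v)))"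
        using t Nd by (intro mult_left_mono) auto
      \<comment> \<open>The endpoint weight \<open>F z\<close> is split as
        \<open>p + (F z - p)\<close>; the surplus pays for the decrease
        \<open>t * \<delta>\<close>.\<close>
      moreover have "(F z - t * \<delta>) * (v \<bullet> (Y w *v v)) = (1 - t) * (F z * (v \<bullet> (Y z *v v)))
          + t * (p * (v \<bullet> (Y (z + d) *v v))) + t * ((F z - p) * (v \<bullet> (Y (z + d) *v v)))
          - t * (\<delta> * (v \<bullet> (Y w *v v)))"
        by (simp add: Yw algebra_simps)
      ultimately show "v \<bullet> (X w *v v) \<le> (F z - t * \<delta>) * (v \<bullet> (Y w *v v))"
        unfolding Xw by linarith
    qed
    then show "F (z + t *\<^sub>R d) \<le> F z - t * \<delta>" by (simp add: F_def w_def)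
  qed
  from clarke_subdiff_descent[OF g \<delta> this] show ?thesis by (simp add: d_def)
qed

section \<open>Semicontinuity and epi-convergence\<close>

text \<open>With one coercivity constant on all of \<open>S\<close>, the perturbation bounds in both
  orders vanish as the matrices converge.\<close>

lemma continuous_on_rayleigh_sup:
  fixes X Y :: "'a::topological_space \<Rightarrow> real^'n^'n"
  assumes X: "continuous_on S X" and Y: "continuous_on S Y" and c: "c > 0"
    and coercive: "\<And>x v. x \<in> S \<Longrightarrow> c * (norm v)\<^sup>2 \<le> v \<bullet> (Y x *v v)"
  shows "continuous_on S (\<lambda>x. rayleigh_sup (X x) (Y x))"
  unfolding continuous_on_def
proof
  fix x assume x: "x \<in> S"
  \<comment> \<open>The sum of both numerator norms lets \<open>g\<close> dominate the bounds in
    either order.\<close>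
  define g where
    "g z = (dist (X z) (X x) + (norm (X x) + norm (X z)) / c * dist (Y z) (Y x)) / c" for z
  have lim: "(X \<longlongrightarrow> X x) (at x within S)" "(Y \<longlongrightarrow> Y x) (at x within S)"
    using X Y x by (auto simp: continuous_on_def)
  have "(g \<longlongrightarrow> (dist (X x) (X x) + (norm (X x) + norm (X x)) / c * dist (Y x) (Y x)) / c)
      (at x within S)"
    unfolding g_def using c by (intro tendsto_intros lim) auto
  then have g: "(g \<longlongrightarrow> 0) (at x within S)" by simp
  have "norm (rayleigh_sup (X z) (Y z) - rayleigh_sup (X x) (Y x)) \<le> g z" if z: "z \<in> S" for z
  proof -
    have "rayleigh_sup (X z) (Y z) \<le> rayleigh_sup (X x) (Y x)
        + (dist (X z) (X x) + norm (X x) / c * dist (Y z) (Y x)) / c"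
      by (rule rayleigh_sup_perturb[OF c coercive[OF x] coercive[OF z]])
    moreover have "rayleigh_sup (X x) (Y x) \<le> rayleigh_sup (X z) (Y z)
        + (dist (X z) (X x) + norm (X z) / c * dist (Y z) (Y x)) / c"
      using rayleigh_sup_perturb[OF c coercive[OF z] coercive[OF x]] by (simp add: dist_commute)
    moreover have "(dist (X z) (X x) + norm (X x) / c * dist (Y z) (Y x)) / c \<le> g z"
      "(dist (X z) (X x) + norm (X z) / c * dist (Y z) (Y x)) / c \<le> g z"
      unfolding g_def using c by (intro divide_right_mono add_left_mono mult_right_mono; simp)+
    ultimately show ?thesis unfolding real_norm_def by linarith
  qed
  then have "((\<lambda>z. rayleigh_sup (X z) (Y z) - rayleigh_sup (X x) (Y x)) \<longlongrightarrow> 0) (at x within S)"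
    by (intro Lim_null_comparison[OF _ g]) (simp add: eventually_at_filter)
  then show "((\<lambda>x. rayleigh_sup (X x) (Y x)) \<longlongrightarrow> rayleigh_sup (X x) (Y x)) (at x within S)"
    by (simp add: LIM_zero_iff)
qed

text \<open>A real level strictly between \<open>y\<close> and \<open>f x\<close> has a sublevel set
  whose complement is an open neighbourhood of \<open>x\<close>.\<close>

lemma lsc_on_closed_sublevel:
  assumes "\<And>\<alpha>::real. closed {x \<in> S. f x \<le> ereal \<alpha>}"
  shows "lsc_on S f"
  unfolding lsc_on_def le_Liminf_iff
proof (intro ballI allI impI)
  fix x y assume x: "x \<in> S" and "y < f x"
  then obtain r where r: "y < ereal r" "ereal r < f x" using ereal_dense2 by blast
  have "open (- {x \<in> S. f x \<le> ereal r})" using assms by blast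
  moreover have "x \<in> - {x \<in> S. f x \<le> ereal r}" using r by auto
  moreover have "y < f z" if "z \<in> - {x \<in> S. f x \<le> ereal r}" "z \<in> S" for z
    using that r(1) by auto
  ultimately show "eventually (\<lambda>z. y < f z) (at x within S)"
    unfolding eventually_at_topological by blast
qed

section \<open>Painleve-Kuratowski limits and epi-convergence\<close>

lemma set_dist_nonneg: "0 \<le> set_dist z C"
  by (auto simp: set_dist_def intro!: INF_greatest)

text \<open>If beyond some index all sets stayed a fixed distance away from \<open>z\<close>, the
  liminf would be positive. Hence points of arbitrarily late sets converge to
  \<open>z\<close>.\<close>

lemma outer_limitE:
  assumes "z \<in> outer_limit C"
  obtains k w where "filterlim k at_top sequentially" "\<And>j. w j \<in> C (k j)" "w \<longlonglongrightarrow> z"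
proof -
  have "\<exists>k w. j \<le> k \<and> w \<in> C k \<and> dist z w < inverse (real (Suc j))" for j
  proof (rule ccontr)
    let ?e = "inverse (real (Suc j))"
    assume "\<not> ?thesis"
    then have "ereal ?e \<le> set_dist z (C k)" if "j \<le> k" for k
      using that by (auto simp: set_dist_def not_less intro!: INF_greatest)
    then have "ereal ?e \<le> liminf (\<lambda>k. set_dist z (C k))"
      by (intro Liminf_bounded) (auto simp: eventually_sequentially)
    with assms show False by (simp add: outer_limit_def)
  qed
  then obtain k w where kw: "\<And>j. j \<le> k j" "\<And>j. w j \<in> C (k j)"
    "\<And>j. dist z (w j) < inverse (real (Suc j))" by metis
  show thesis
  proof (rule that[OF _ kw(2)])
    show "filterlim k at_top sequentially"
      by (rule filterlim_at_top_mono[OF filterlim_ident]) (simp add: kw)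
    have "(\<lambda>j. dist (w j) z) \<longlonglongrightarrow> 0"
      by (rule tendsto_sandwich[OF _ _ tendsto_const LIMSEQ_inverse_real_of_nat])
        (use kw(3) in \<open>auto simp: dist_commute less_imp_le intro!: always_eventually\<close>)
    then show "w \<longlonglongrightarrow> z" by (subst tendsto_dist_iff)
  qed
qed

text \<open>Points of \<open>epi g\<close> have distance 0 to every \<open>epi (f k)\<close>, so
  they lie in the inner limit. The inner limit is contained in the outer one, and the assumption on
  the latter closes the chain.\<close>

lemma epi_convergesI:
  assumes outer: "outer_limit (\<lambda>k. epi (f k)) \<subseteq> epi g" and mono: "\<And>k. epi g \<subseteq> epi (f k)"
  shows "epi_converges f g"
proof -
  have inner: "epi g \<subseteq> inner_limit (\<lambda>k. epi (f k))"
  proof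
    fix z assume "z \<in> epi g"
    then have "set_dist z (epi (f k)) \<le> ereal (dist z z)" for k
      unfolding set_dist_def using mono by (intro INF_lower) blast
    then have "set_dist z (epi (f k)) = 0" for k
      using set_dist_nonneg by (metis antisym dist_self zero_ereal_def)
    then show "z \<in> inner_limit (\<lambda>k. epi (f k))"
      by (simp add: inner_limit_def Limsup_const)
  qed
  have "inner_limit C \<subseteq> outer_limit C" for C :: "nat \<Rightarrow> ('a \<times> real) set"
  proof
    fix z assume "z \<in> inner_limit C"
    then have "liminf (\<lambda>k. set_dist z (C k)) \<le> 0"
      using Liminf_le_Limsup[of sequentially "\<lambda>k. set_dist z (C k)"] by (simp add: inner_limit_def)
    moreover have "0 \<le> liminf (\<lambda>k. set_dist z (C k))"
      by (intro Liminf_bounded always_eventually allI set_dist_nonneg)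
    ultimately show "z \<in> outer_limit C" by (simp add: outer_limit_def)
  qed
  with outer inner show ?thesis unfolding epi_converges_def by blast
qed

lemma epi_extend_inf_iff: "(x, \<alpha>) \<in> epi (extend_inf S f) \<longleftrightarrow> x \<in> S \<and> f x \<le> ereal \<alpha>"
  by (simp add: epi_def extend_inf_def)

text \<open>Real-valued continuity is expressed as finiteness together with continuity of
  \<open>real_of_ereal\<close>. The extensions \<open>A'\<close> and \<open>B'\<close> are
  quantified, but affine maps agreeing on the orthant agree everywhere, so they are the natural
  ones.\<close>

theorem corollary6:
  fixes S :: "(real^'m) set" and A B :: "real^'m \<Rightarrow> real^'n^'n"
  assumes "closed S"
    and "A \<in> S \<rightarrow> psd_matrices" and "B \<in> S \<rightarrow> psd_matrices"
    and "continuous_on S A" and "continuous_on S B"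
  shows "(\<forall>x\<in>S. 0 \<le> lambda_max (A x) (B x)) \<and>
    lsc_on S (\<lambda>x. lambda_max (A x) (B x)) \<and>
    (\<forall>\<epsilon>>0. (\<forall>x\<in>S. \<bar>lambda_max (A x) (B x + \<epsilon> *\<^sub>R mat 1)\<bar> \<noteq> \<infinity>) \<and>
       continuous_on S (\<lambda>x. real_of_ereal (lambda_max (A x) (B x + \<epsilon> *\<^sub>R mat 1)))) \<and>
    epi_converges_at_right_0
       (\<lambda>\<epsilon>. extend_inf S (\<lambda>x. lambda_max (A x) (B x + \<epsilon> *\<^sub>R mat 1)))
       (extend_inf S (\<lambda>x. lambda_max (A x) (B x))) \<and>
    (S = nonneg_orthant \<and> affine_on S A \<and> affine_on S B \<longrightarrow>
       quasiconvex_on S (\<lambda>x. lambda_max (A x) (B x)) \<and>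
       (\<forall>\<epsilon>>0. \<forall>A' B'.
          affine_map A' \<and> affine_map B' \<and> (\<forall>x\<in>S. A' x = A x \<and> B' x = B x) \<longrightarrow>
          pseudoconvex_on S (\<lambda>x. real_of_ereal (lambda_max (A x) (B x + \<epsilon> *\<^sub>R mat 1)))
            {x. B' x + \<epsilon> *\<^sub>R mat 1 \<in> pd_matrices}
            (\<lambda>x. rayleigh_sup (A' x) (B' x + \<epsilon> *\<^sub>R mat 1))))"
proof -
  have A: "A x \<in> psd_matrices" and B: "B x \<in> psd_matrices" if "x \<in> S" for x
    using assms(2,3) that by auto
  have Be: "B x + \<epsilon> *\<^sub>R mat 1 \<in> psd_matrices" if "x \<in> S" "\<epsilon> > 0" for x \<epsilon>
    using that by (intro psd_matrices_add psd_matrices_scaleR mat_1_psd B) auto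
  \<comment> \<open>Since \<open>B x\<close> is semidefinite, \<open>\<epsilon>\<close> itself is a
    coercivity constant, uniformly on \<open>S\<close>.\<close>
  have coercive: "\<epsilon> * (norm v)\<^sup>2 \<le> v \<bullet> ((B x + \<epsilon> *\<^sub>R mat 1) *v v)" if "x \<in> S" for x v \<epsilon>
    using B[OF that] by (simp only: quadratic_form_simps psd_matrices_def) simp
  have ray: "lambda_max (A x) (B x + \<epsilon> *\<^sub>R mat 1) = ereal (rayleigh_sup (A x) (B x + \<epsilon> *\<^sub>R mat 1))"
    if "x \<in> S" "\<epsilon> > 0" for x \<epsilon>
    by (rule rayleigh_sup_coercive(3)[OF that(2) coercive[OF that(1)]])
  have le: "lambda_max (A x) (B x) \<le> ereal \<alpha> \<longleftrightarrow> 0 \<le> \<alpha> \<and> \<alpha> *\<^sub>R B x - A x \<in> psd_matrices"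
    if "x \<in> S" for x \<alpha>
    by (rule lambda_max_le_iff[OF A[OF that] B[OF that]])
  have nonneg: "\<forall>x\<in>S. 0 \<le> lambda_max (A x) (B x)"
    using lambda_max_nonneg[OF A B] by blast
  have lsc: "lsc_on S (\<lambda>x. lambda_max (A x) (B x))"
  proof (rule lsc_on_closed_sublevel)
    fix \<alpha> :: real
    \<comment> \<open>Negative levels give the empty set; the others give the preimage of a closed
      cone under a continuous map.\<close>
    have "{x \<in> S. lambda_max (A x) (B x) \<le> ereal \<alpha>} =
        (if 0 \<le> \<alpha> then S \<inter> (\<lambda>x. \<alpha> *\<^sub>R B x - A x) -` psd_matrices else {})"
      by (auto simp: le)
    moreover have "closed (S \<inter> (\<lambda>x. \<alpha> *\<^sub>R B x - A x) -` psd_matrices)"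
      using assms(1,4,5) closed_psd_matrices
      by (intro continuous_closed_preimage continuous_intros)
    ultimately show "closed {x \<in> S. lambda_max (A x) (B x) \<le> ereal \<alpha>}" by simp
  qed
  have cont: "continuous_on S (\<lambda>x. real_of_ereal (lambda_max (A x) (B x + \<epsilon> *\<^sub>R mat 1)))"
    if "\<epsilon> > 0" for \<epsilon>
  proof -
    have "continuous_on S (\<lambda>x. rayleigh_sup (A x) (B x + \<epsilon> *\<^sub>R mat 1))"
      using coercive that by (intro continuous_on_rayleigh_sup[where c = \<epsilon>] continuous_intros assms)
    then show ?thesis
      by (rule continuous_on_eq) (simp add: ray that)
  qed
  have epi: "epi_converges_at_right_0
       (\<lambda>\<epsilon>. extend_inf S (\<lambda>x. lambda_max (A x) (B x + \<epsilon> *\<^sub>R mat 1)))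
       (extend_inf S (\<lambda>x. lambda_max (A x) (B x)))"
    unfolding epi_converges_at_right_0_def
  proof (intro allI impI epi_convergesI)
    fix \<epsilon> :: "nat \<Rightarrow> real"
    assume \<epsilon>: "\<forall>k. 0 < \<epsilon> k" "\<epsilon> \<longlonglongrightarrow> 0"
    have leE: "lambda_max (A x) (B x + \<epsilon> k *\<^sub>R mat 1) \<le> ereal \<alpha> \<longleftrightarrow>
        0 \<le> \<alpha> \<and> \<alpha> *\<^sub>R (B x + \<epsilon> k *\<^sub>R mat 1) - A x \<in> psd_matrices" if "x \<in> S" for x \<alpha> k
      using \<epsilon>(1) by (intro lambda_max_le_iff A Be that) auto
    fix k
    show "epi (extend_inf S (\<lambda>x. lambda_max (A x) (B x)))
        \<subseteq> epi (extend_inf S (\<lambda>x. lambda_max (A x) (B x + \<epsilon> k *\<^sub>R mat 1)))"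
    proof clarify
      fix x \<alpha>
      assume "(x, \<alpha>) \<in> epi (extend_inf S (\<lambda>x. lambda_max (A x) (B x)))"
      then have x: "x \<in> S" "0 \<le> \<alpha>" "\<alpha> *\<^sub>R B x - A x \<in> psd_matrices"
        by (auto simp: epi_extend_inf_iff le)
      \<comment> \<open>Regularization adds a nonnegative multiple of the identity, so the cone
        condition persists and the epigraph only grows.\<close>
      have "(\<alpha> *\<^sub>R B x - A x) + (\<alpha> * \<epsilon> k) *\<^sub>R mat 1 \<in> psd_matrices"
        using x \<epsilon>(1) by (intro psd_matrices_add psd_matrices_scaleR mat_1_psd) (auto simp: less_imp_le)
      then show "(x, \<alpha>) \<in> epi (extend_inf S (\<lambda>x. lambda_max (A x) (B x + \<epsilon> k *\<^sub>R mat 1)))"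
        using x by (simp add: epi_extend_inf_iff leE algebra_simps)
    qed
  next
    fix \<epsilon> :: "nat \<Rightarrow> real"
    assume \<epsilon>: "\<forall>k. 0 < \<epsilon> k" "\<epsilon> \<longlonglongrightarrow> 0"
    show "outer_limit (\<lambda>k. epi (extend_inf S (\<lambda>x. lambda_max (A x) (B x + \<epsilon> k *\<^sub>R mat 1))))
        \<subseteq> epi (extend_inf S (\<lambda>x. lambda_max (A x) (B x)))"
    proof clarify
      fix x \<alpha>
      assume "(x, \<alpha>) \<in> outer_limit
        (\<lambda>k. epi (extend_inf S (\<lambda>x. lambda_max (A x) (B x + \<epsilon> k *\<^sub>R mat 1))))"
      then obtain k w where k: "filterlim k at_top sequentially"
        and w: "\<And>j. w j \<in> epi (extend_inf S (\<lambda>x. lambda_max (A x) (B x + \<epsilon> (k j) *\<^sub>R mat 1)))"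
        and lim: "w \<longlonglongrightarrow> (x, \<alpha>)"
        by (erule outer_limitE)
      define y \<beta> where "y = fst \<circ> w" and "\<beta> = snd \<circ> w"
      have y: "y \<longlonglongrightarrow> x" and \<beta>: "\<beta> \<longlonglongrightarrow> \<alpha>"
        using tendsto_fst[OF lim] tendsto_snd[OF lim] by (simp_all add: y_def \<beta>_def comp_def)
      have "(y j, \<beta> j) \<in> epi (extend_inf S (\<lambda>x. lambda_max (A x) (B x + \<epsilon> (k j) *\<^sub>R mat 1)))" for j
        using w[of j] by (simp add: y_def \<beta>_def)
      then have yS: "y j \<in> S"
        and "lambda_max (A (y j)) (B (y j) + \<epsilon> (k j) *\<^sub>R mat 1) \<le> ereal (\<beta> j)" for j
        by (auto simp: epi_extend_inf_iff)
      then have \<beta>0: "0 \<le> \<beta> j"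
        and psd: "\<beta> j *\<^sub>R (B (y j) + \<epsilon> (k j) *\<^sub>R mat 1) - A (y j) \<in> psd_matrices" for j
        using lambda_max_le_iff[OF A[OF yS] Be[OF yS]] \<epsilon>(1) by blast+
      have x: "x \<in> S" using closed_sequentially[OF assms(1) yS y] .
      have "(\<lambda>j. \<epsilon> (k j)) \<longlonglongrightarrow> 0" by (rule filterlim_compose[OF \<epsilon>(2) k])
      moreover have "(\<lambda>j. A (y j)) \<longlonglongrightarrow> A x" "(\<lambda>j. B (y j)) \<longlonglongrightarrow> B x"
        using continuous_on_tendsto_compose[OF assms(4) y x] continuous_on_tendsto_compose[OF assms(5) y x]
          yS by auto
      \<comment> \<open>The levels \<open>\<beta> j\<close> converge as well, so the regularizing
        term disappears in the limit and closedness of the cone applies.\<close>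
      ultimately have "(\<lambda>j. \<beta> j *\<^sub>R (B (y j) + \<epsilon> (k j) *\<^sub>R mat 1) - A (y j))
          \<longlonglongrightarrow> \<alpha> *\<^sub>R (B x + 0 *\<^sub>R mat 1) - A x"
        by (intro tendsto_intros \<beta>)
      then have "\<alpha> *\<^sub>R (B x + 0 *\<^sub>R mat 1) - A x \<in> psd_matrices"
        by (rule closed_sequentially[OF closed_psd_matrices psd])
      moreover have "0 \<le> \<alpha>" using LIMSEQ_le_const[OF \<beta>] \<beta>0 by blast
      ultimately show "(x, \<alpha>) \<in> epi (extend_inf S (\<lambda>x. lambda_max (A x) (B x)))"
        using x by (simp add: epi_extend_inf_iff le)
    qed
  qed

  \<comment> \<open>Quasiconvexity and pseudoconvexity on the orthant\<close>
  have convex: "convex (nonneg_orthant :: (real^'m) set)"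
    by (auto simp: convex_alt nonneg_orthant_def)
  have "0 \<in> (nonneg_orthant :: (real^'m) set)" by (simp add: nonneg_orthant_def)
  then have nonempty: "nonneg_orthant \<noteq> ({} :: (real^'m) set)" by blast
  have quasi: "quasiconvex_on S (\<lambda>x. lambda_max (A x) (B x))"
    if S: "S = nonneg_orthant" and "affine_on S A" "affine_on S B"
  proof -
    obtain A' B' where A': "affine_map A'" "\<And>x. x \<in> S \<Longrightarrow> A' x = A x"
      and B': "affine_map B'" "\<And>x. x \<in> S \<Longrightarrow> B' x = B x"
      using \<open>affine_on S A\<close> \<open>affine_on S B\<close> by (auto simp: affine_on_def)
    have "convex {x \<in> S. lambda_max (A x) (B x) \<le> ereal \<alpha>}" for \<alpha>
      unfolding convex_alt
    proof (intro ballI allI impI)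
      fix x y and t :: real
      assume x: "x \<in> {x \<in> S. lambda_max (A x) (B x) \<le> ereal \<alpha>}"
        and y: "y \<in> {x \<in> S. lambda_max (A x) (B x) \<le> ereal \<alpha>}" and t: "0 \<le> t \<and> t \<le> 1"
      define z where "z = (1 - t) *\<^sub>R x + t *\<^sub>R y"
      have z: "z \<in> S" using x y t convex S unfolding z_def convex_alt by blast
      have "(1 - t) *\<^sub>R (\<alpha> *\<^sub>R B x - A x) + t *\<^sub>R (\<alpha> *\<^sub>R B y - A y) \<in> psd_matrices"
        using x y t by (intro psd_matrices_add psd_matrices_scaleR) (auto simp: le)
      \<comment> \<open>For a fixed level, \<open>\<alpha> *\<^sub>R B' z - A' z\<close> is affine
        in \<open>z\<close>, so it maps convex combinations into the convex cone.\<close>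
      also have "(1 - t) *\<^sub>R (\<alpha> *\<^sub>R B x - A x) + t *\<^sub>R (\<alpha> *\<^sub>R B y - A y) = \<alpha> *\<^sub>R B' z - A' z"
        unfolding z_def affine_map_convex_comb[OF A'(1)] affine_map_convex_comb[OF B'(1)]
        using x y by (simp add: A' B' algebra_simps)
      finally show "(1 - t) *\<^sub>R x + t *\<^sub>R y \<in> {x \<in> S. lambda_max (A x) (B x) \<le> ereal \<alpha>}"
        using x z by (auto simp: le A' B' z_def[symmetric])
    qed
    moreover have "\<forall>x\<in>S. lambda_max (A x) (B x) \<noteq> -\<infinity>" using nonneg by force
    ultimately show ?thesis
      using convex nonempty unfolding quasiconvex_on_def S by blast
  qed
  have pseudo: "pseudoconvex_on S (\<lambda>x. real_of_ereal (lambda_max (A x) (B x + \<epsilon> *\<^sub>R mat 1)))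
      {x. B' x + \<epsilon> *\<^sub>R mat 1 \<in> pd_matrices}
      (\<lambda>x. rayleigh_sup (A' x) (B' x + \<epsilon> *\<^sub>R mat 1))"
    if S: "S = nonneg_orthant" and \<epsilon>: "\<epsilon> > 0" and A': "affine_map A'" and B': "affine_map B'"
      and eq: "\<forall>x\<in>S. A' x = A x \<and> B' x = B x" for \<epsilon> A' B'
  proof -
    define Y where "Y = (\<lambda>x. B' x + \<epsilon> *\<^sub>R mat 1)"
    define F where "F = (\<lambda>x. rayleigh_sup (A' x) (Y x))"
    let ?U = "{x. Y x \<in> pd_matrices}"
    have Y: "affine_map Y" unfolding Y_def by (rule affine_map_add_const[OF B'])
    have sym: "transpose (Y x) = Y x" for x
    proof (rule affine_map_symmetric[OF Y])
      fix x :: "real^'m" assume "x \<in> nonneg_orthant"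
      then show "transpose (Y x) = Y x"
        using Be[OF _ \<epsilon>, of x] eq S by (simp add: Y_def psd_matrices_def)
    qed
    have SU: "S \<subseteq> ?U"
    proof
      fix x assume x: "x \<in> S"
      have "0 < v \<bullet> (Y x *v v)" if "v \<noteq> 0" for v
      proof -
        have "0 < \<epsilon> * (norm v)\<^sup>2" using \<epsilon> that by simp
        also have "\<dots> \<le> v \<bullet> (Y x *v v)" using coercive[OF x, of \<epsilon> v] eq x by (simp add: Y_def)
        finally show ?thesis .
      qed
      then show "x \<in> ?U" by (simp add: pd_matrices_def sym)
    qed
    have F: "real_of_ereal (lambda_max (A x) (B x + \<epsilon> *\<^sub>R mat 1)) = F x" if "x \<in> S" for x
      using that eq by (simp add: ray \<epsilon> F_def Y_def)
    have lip: "locally_lipschitz_on ?U F"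
      unfolding F_def by (rule locally_lipschitz_rayleigh_sup[OF A' Y])
    \<comment> \<open>The Lipschitz property of the extension \<open>F\<close> on the open set
      restricts to \<open>S\<close>, where both functions agree.\<close>
    have "locally_lipschitz_on S (\<lambda>x. real_of_ereal (lambda_max (A x) (B x + \<epsilon> *\<^sub>R mat 1)))"
      using locally_lipschitz_on_subset[OF lip SU]
      by (simp add: locally_lipschitz_on_def lipschitz_on_def F)
    moreover have "g \<bullet> (y - x) < 0"
      if "x \<in> S" "y \<in> S" "g \<in> clarke_subdiff F x" "F y < F x" for x y g
      using rayleigh_sup_clarke_descent[OF A' Y sym, of x y g] that SU
      unfolding F_def by blast
    ultimately have "pseudoconvex_on S
        (\<lambda>x. real_of_ereal (lambda_max (A x) (B x + \<epsilon> *\<^sub>R mat 1))) ?U F"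
      using convex nonempty S SU lip open_pd_preimage[OF Y sym]
      unfolding pseudoconvex_on_def by (simp add: F)
    then show ?thesis unfolding F_def Y_def .
  qed
  have finite: "\<bar>lambda_max (A x) (B x + \<epsilon> *\<^sub>R mat 1)\<bar> \<noteq> \<infinity>" if "x \<in> S" "\<epsilon> > 0" for x \<epsilon>
    using that by (simp add: ray)
  show ?thesis
    by (intro conjI impI allI ballI)
      (use nonneg lsc finite cont epi quasi pseudo in auto)
qed

end
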